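(* In the power-beacon assisted multi-source network described in the context, the average transmission probability of source $S_i$ and its average transmission delay (ATD) are $$p_{T,i}=\sum_{\vec s_n\in\Theta}\pi_n\,p_{T,i}^n=\sum_{\vec s_n\in\Theta_2}\pi_n\,p_{T,i}^n$$ and $$\bar T_i=\frac{T_0}{p_{T,i}}=\frac{T_0}{\sum_{\vec s_n\in\Theta_2}\pi_n\,p_{T,i}^n},$$ respectively, where $\pi_n$, the stationary probability of the energy state $\vec s_n$, is the $n$-th element of $$\boldsymbol\pi=\left(\mathbf A^{T}-\mathbf E+\mathbf Q\right)^{-1}\mathbf b ,$$ with $\mathbf A\in\mathbb R^{N\times N}$ the state transition matrix, $\mathbf E$ the identity matrix, $\mathbf Q$ the all-ones matrix and $\mathbf b=(1,1,\dots,1)^T$.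
   Context: Network. There are a power beacon $B$ with $N_B$ antennas and transmit power $P_B$, $K$ single-antenna half-duplex sources $S_1,\dots,S_K$, and a single-antenna destination $D$. Time is divided into slots (blocks) of length $T_0$. All channels experience quasi-static Rayleigh fading: the coefficient $h_{ab}$ between $a$ and $b$ is zero-mean complex Gaussian with $\mathbb E|h_{ab}|^2=\bar\gamma_{ab}=d_{ab}^{-\alpha}$ ($d_{ab}$ the distance, $\alpha$ the path-loss factor), is constant during a slot, and changes independently from slot to slot. Write $\mathbf h_{BS_k}=[h_{B_1S_k},\dots,h_{B_{N_B}S_k}]^T$ and $\mathbf h_{BD}=[h_{B_1D},\dots,h_{B_{N_B}D}]^T$ for the channel vectors from the antennas of $B$ to $S_k$ and to $D$. Energy levels and states. Each source has an energy storage of finite capacity $\varepsilon_T$, discretized into the $1+L$ levels $\varepsilon_l=l\,\varepsilon_\Delta$, $l\in\{0,1,\dots,L\}$, with $\varepsilon_\Delta=\varepsilon_T/L$. Harvested energy is rounded down to the largest level not exceeding it before being stored, and a storage cannot exceed level $L$. There are $N=(1+L)^K$ energy states $\vec s_n=[l_1^n,\dots,l_K^n]$, $l_k^n\in\{0,\dots,L\}$, forming the set $\Theta$; $l_k^n$ is the energy level of $S_k$ at state $\vec s_n$. Thresholds. Let $\varepsilon_S^{th}$ be the transmit energy threshold of the sources and $l_S^{th}=\arg\min_{l\in\{1,\dots,L\}}\{\varepsilon_l:\varepsilon_l\ge\varepsilon_S^{th}\}$ the transmit energy level threshold. The actual transmit energy level is $l_S$, with $l_S^{th}\le l_S\le L$,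 and the transmit power of the sources is $P_S=l_S\varepsilon_\Delta/T_0$. Put $\vartheta_n^{TH}=\{k:l_k^n\ge l_S^{th}\}$, $\Theta_1=\{\vec s_n:\vartheta_n^{TH}=\emptyset\}$ (states in which no information is transmitted) and $\Theta_2=\{\vec s_n:\vartheta_n^{TH}\ne\emptyset\}$ (information-transmission states). Operation in one slot, from state $\vec s_n$ ($\eta$ is the energy conversion efficiency). (i) If $\vec s_n\in\Theta_1$, no source transmits and every $S_k$ harvests $\varepsilon_k^n=\eta T_0P_B|\mathbf h_{BS_k}^T\mathbf w_1|^2$, where all entries of $\mathbf w_1$ equal $1/\sqrt{N_B}$. (ii) If $\vec s_n\in\Theta_2$, the source with index $i^*=\arg\max_{k\in\vartheta_n^{TH}}|h_{S_kD}|^2$ is selected to transmit information; its energy level declines by $l_S^{th}$. Every other source $S_k$, $k\ne i^*$, harvests $\varepsilon_k^{n,i^*}=\eta T_0\left(P_S|h_{S_{i^*}S_k}|^2+P_B|\mathbf h_{BS_k}^T\mathbf w_2|^2\right)$, where $\mathbf w_2$ is a normalized zero-forcing weight vector constructed from $\mathbf h_{BD}$ with $\mathbf h_{BD}^T\mathbf w_2=0$. Markov chain. The $(n,n')$ entry of $\mathbf A$ is the probability of moving from $\vec s_n$ to $\vec s_{n'}$ in one step. $\mathbf A$ is taken to be irreducible and row stochastic, so that there is a unique stationary distribution $\boldsymbol\pi$, satisfying $\boldsymbol\pi=\mathbf A^T\boldsymbol\pi$. Transmission probability and delay. The transmission probability of $S_i$ at state $\vec s_n$ is $$p_{T,i}^n=\begin{cases}0,&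 l_i^n<l_S,\\ p_i^n,& l_i^n\ge l_S,\end{cases}$$ where $p_i^n=\Pr(S_{i^*}=S_i)$ is the probability that $S_i$ is selected for information transmission at state $\vec s_n$. The average transmission probability $p_{T,i}$ is the average of $p_{T,i}^n$ over the states. The ATD $\bar T_i$ quantifies how many time slots on average $S_i$ needs to wait to be selected for information transmission; for example, if $K$ energy-sufficient sources are selected equally likely, each has transmission probability $1/K$ in each slot, is allocated one slot on average within $K$ slots, and has ATD $KT_0$. *)

theory Defs
  imports "HOL-Probability.Probability"
begin

text \<open>The index type \<^typ>\<open>'nb\<close> stands for the antennas of the beacon and \<^typ>\<open>'k\<close> for the
  sources, so the number of antennas and the number of sources are the cardinalities of these
  types.\<close>

datatype 'k terminal = Beacon | Source 'k | Dest

datatype ('nb, 'k) link = BS 'nb 'k | BD 'nb | SD 'k | SS 'k 'k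

record ('nb, 'k) network =
  distance :: "'k terminal \<Rightarrow> 'k terminal \<Rightarrow> real"
  path_loss :: real
  beacon_power :: real
  efficiency :: real
  slot_length :: real
  capacity :: real
  top_level :: nat
  tx_threshold :: real
  tx_level :: nat
  zf_weight :: "complex ^ 'nb::finite \<Rightarrow> complex ^ 'nb"


subsection \<open>Energy levels and states\<close>

definition energy_unit :: "('nb::finite, 'k) network \<Rightarrow> real" where
  "energy_unit net = capacity net / real (top_level net)"

definition level_energy :: "('nb::finite, 'k) network \<Rightarrow> nat \<Rightarrow> real" where
  "level_energy net l = real l * energy_unit net"

definition threshold_level :: "('nb::finite, 'k) network \<Rightarrow> nat" where
  "threshold_level net =
     arg_min (level_energy net) (\<lambda>l. l \<in> {1..top_level net} \<and> level_energy net l \<ge> tx_threshold net)"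

definition source_power :: "('nb::finite, 'k) network \<Rightarrow> real" where
  "source_power net = real (tx_level net) * energy_unit net / slot_length net"

type_synonym 'k state = "'k \<Rightarrow> nat"

definition states :: "('nb::finite, 'k) network \<Rightarrow> 'k state set" where
  "states net = {s. \<forall>k. s k \<le> top_level net}"

definition eligible :: "('nb::finite, 'k) network \<Rightarrow> 'k state \<Rightarrow> 'k set" where
  "eligible net s = {k. s k \<ge> threshold_level net}"

definition tx_states :: "('nb::finite, 'k) network \<Rightarrow> 'k state set" where
  "tx_states net = {s \<in> states net. eligible net s \<noteq> {}}"

text \<open>Besides the ranges of the scalar parameters, the zero-forcing map is required to be a
  measurable function of the beacon-destination channel vector that is normalized and orthogonal
  to it (without conjugation). This is only demanded almost everywhere because explicit
  zero-forcing constructions degenerate on null sets.\<close>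

definition valid_network :: "('nb::finite, 'k::finite) network \<Rightarrow> bool" where
  "valid_network net \<longleftrightarrow>
     (\<forall>a b. a \<noteq> b \<longrightarrow> distance net a b > 0) \<and>
     beacon_power net > 0 \<and> efficiency net > 0 \<and> slot_length net > 0 \<and>
     capacity net > 0 \<and> top_level net \<ge> 1 \<and>
     tx_threshold net \<le> capacity net \<and>
     threshold_level net \<le> tx_level net \<and> tx_level net \<le> top_level net \<and>
     CARD('nb) \<ge> 2 \<and>
     zf_weight net \<in> borel_measurable borel \<and>
     (AE g in lborel. norm (zf_weight net g) = 1 \<and> (\<Sum>m\<in>UNIV. g $ m * zf_weight net g $ m) = 0)"


subsection \<open>Channels\<close>

text \<open>Circularly symmetric complex Gaussian law with mean zero and second absolute moment
  \<open>v > 0\<close>.\<close>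

definition complex_gaussian :: "real \<Rightarrow> complex measure" where
  "complex_gaussian v =
     (let N = density lborel (\<lambda>x. ennreal (normal_density 0 (sqrt (v / 2)) x))
      in distr (N \<Otimes>\<^sub>M N) borel (\<lambda>(x, y). Complex x y))"

primrec mean_gain :: "('nb::finite, 'k) network \<Rightarrow> ('nb, 'k) link \<Rightarrow> real" where
  "mean_gain net (BS m k) = distance net Beacon (Source k) powr (- path_loss net)"
| "mean_gain net (BD m) = distance net Beacon Dest powr (- path_loss net)"
| "mean_gain net (SD k) = distance net (Source k) Dest powr (- path_loss net)"
| "mean_gain net (SS j k) = distance net (Source j) (Source k) powr (- path_loss net)"

text \<open>Joint law of all channel coefficients within one slot. The non-existing channels from a
  source to itself are left out of the product.\<close>

definition slot_law :: "('nb::finite, 'k) network \<Rightarrow> (('nb, 'k) link \<Rightarrow> complex) measure" where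
  "slot_law net = (\<Pi>\<^sub>M c \<in> {c. \<forall>k. c \<noteq> SS k k}. complex_gaussian (mean_gain net c))"


subsection \<open>Operation in one slot\<close>

definition selected ::
  "('nb::finite, 'k) network \<Rightarrow> 'k state \<Rightarrow> (('nb, 'k) link \<Rightarrow> complex) \<Rightarrow> 'k option" where
  "selected net s h =
     (if eligible net s = {} then None
      else Some (arg_max (\<lambda>k. (cmod (h (SD k)))\<^sup>2) (\<lambda>k. k \<in> eligible net s)))"

definition beamformed ::
  "(('nb::finite, 'k) link \<Rightarrow> complex) \<Rightarrow> 'k \<Rightarrow> complex ^ 'nb \<Rightarrow> complex" where
  "beamformed h k w = (\<Sum>m\<in>UNIV. h (BS m k) * w $ m)"

definition uniform_weight :: "complex ^ 'nb::finite" where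
  "uniform_weight = (\<chi> m. complex_of_real (1 / sqrt (real CARD('nb))))"

definition harvested ::
  "('nb::finite, 'k) network \<Rightarrow> 'k option \<Rightarrow> (('nb, 'k) link \<Rightarrow> complex) \<Rightarrow> 'k \<Rightarrow> real" where
  "harvested net sel h k =
     (case sel of
        None \<Rightarrow> efficiency net * slot_length net *
          (beacon_power net * (cmod (beamformed h k uniform_weight))\<^sup>2)
      | Some j \<Rightarrow> efficiency net * slot_length net *
          (source_power net * (cmod (h (SS j k)))\<^sup>2 +
           beacon_power net * (cmod (beamformed h k (zf_weight net (\<chi> m. h (BD m)))))\<^sup>2))"

definition quantize :: "('nb::finite, 'k) network \<Rightarrow> real \<Rightarrow> nat" where
  "quantize net e = Max {l \<in> {0..top_level net}. level_energy net l \<le> e}"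

definition next_state ::
  "('nb::finite, 'k) network \<Rightarrow> 'k state \<Rightarrow> (('nb, 'k) link \<Rightarrow> complex) \<Rightarrow> 'k state" where
  "next_state net s h = (\<lambda>k.
     if selected net s h = Some k then s k - threshold_level net
     else min (top_level net) (s k + quantize net (harvested net (selected net s h) h k)))"


subsection \<open>The Markov chain of energy states\<close>

definition step_prob :: "('nb::finite, 'k) network \<Rightarrow> 'k state \<Rightarrow> 'k state \<Rightarrow> real" where
  "step_prob net s s' = \<P>(h in slot_law net. next_state net s h = s')"

text \<open>The states are enumerated by a function from a finite index type onto \<^const>\<open>states\<close>.\<close>

definition transition_matrix ::
  "('nb::finite, 'k) network \<Rightarrow> ('n::finite \<Rightarrow> 'k state) \<Rightarrow> real ^ 'n ^ 'n" where
  "transition_matrix net \<sigma> = (\<chi> n n'. step_prob net (\<sigma> n) (\<sigma> n'))"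

definition row_stochastic :: "real ^ 'n ^ 'n::finite \<Rightarrow> bool" where
  "row_stochastic A \<longleftrightarrow> (\<forall>p q. A $ p $ q \<ge> 0) \<and> (\<forall>p. (\<Sum>q\<in>UNIV. A $ p $ q) = 1)"

definition irreducible_matrix :: "real ^ 'n ^ 'n::finite \<Rightarrow> bool" where
  "irreducible_matrix A \<longleftrightarrow> (\<forall>p q. (p, q) \<in> {(p, q). A $ p $ q \<noteq> 0}\<^sup>*)"

definition is_stationary :: "('nb::finite, 'k) network \<Rightarrow> 'k state pmf \<Rightarrow> bool" where
  "is_stationary net \<nu> \<longleftrightarrow>
     set_pmf \<nu> \<subseteq> states net \<and>
     (\<forall>s' \<in> states net. pmf \<nu> s' = (\<Sum>s \<in> states net. step_prob net s s' * pmf \<nu> s))"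

definition stationary_law :: "('nb::finite, 'k) network \<Rightarrow> 'k state pmf" where
  "stationary_law net = (THE \<nu>. is_stationary net \<nu>)"

definition stationary_vector ::
  "('nb::finite, 'k) network \<Rightarrow> ('n::finite \<Rightarrow> 'k state) \<Rightarrow> real ^ 'n" where
  "stationary_vector net \<sigma> = (\<chi> n. pmf (stationary_law net) (\<sigma> n))"


subsection \<open>Transmission probability\<close>

definition selection_prob :: "('nb::finite, 'k) network \<Rightarrow> 'k state \<Rightarrow> 'k \<Rightarrow> real" where
  "selection_prob net s i = \<P>(h in slot_law net. selected net s h = Some i)"

definition tx_prob :: "('nb::finite, 'k) network \<Rightarrow> 'k state \<Rightarrow> 'k \<Rightarrow> real" where
  "tx_prob net s i = (if s i < tx_level net then 0 else selection_prob net s i)"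

definition avg_tx_prob :: "('nb::finite, 'k) network \<Rightarrow> 'k \<Rightarrow> real" where
  "avg_tx_prob net i = measure_pmf.expectation (stationary_law net) (\<lambda>s. tx_prob net s i)"


subsection \<open>Transmission delay\<close>

text \<open>A sample point of the slotted operation consists of the initial energy state and the
  sequence of channel realizations, which are independent from slot to slot.\<close>

type_synonym ('nb, 'k) sample = "'k state \<times> (nat \<Rightarrow> ('nb, 'k) link \<Rightarrow> complex)"

definition operation_law ::
  "('nb::finite, 'k) network \<Rightarrow> 'k state pmf \<Rightarrow> ('nb, 'k) sample measure" where
  "operation_law net \<nu> = measure_pmf \<nu> \<Otimes>\<^sub>M (\<Pi>\<^sub>M t\<in>UNIV. slot_law net)"

primrec energy_state :: "('nb::finite, 'k) network \<Rightarrow> ('nb, 'k) sample \<Rightarrow> nat \<Rightarrow> 'k state" where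
  "energy_state net \<omega> 0 = fst \<omega>"
| "energy_state net \<omega> (Suc t) = next_state net (energy_state net \<omega> t) (snd \<omega> t)"

text \<open>A selected source counts as transmitting only if its level is at least the actual transmit
  level, as in \<^const>\<open>tx_prob\<close>.\<close>

definition transmits ::
  "('nb::finite, 'k) network \<Rightarrow> 'k \<Rightarrow> ('nb, 'k) sample \<Rightarrow> nat \<Rightarrow> bool" where
  "transmits net i \<omega> t \<longleftrightarrow>
     selected net (energy_state net \<omega> t) (snd \<omega> t) = Some i \<and> energy_state net \<omega> t i \<ge> tx_level net"

text \<open>Number of slots after slot 0 up to and including the next transmission; infinite if there
  is none.\<close>

definition waiting_slots :: "('nb::finite, 'k) network \<Rightarrow> 'k \<Rightarrow> ('nb, 'k) sample \<Rightarrow> ennreal" where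
  "waiting_slots net i \<omega> = (INF t \<in> {t. 0 < t \<and> transmits net i \<omega> t}. of_nat t)"

text \<open>Mean time between two consecutive transmissions of a source in the stationary regime:
  the waiting time is averaged conditionally on a transmission in slot 0.\<close>

definition avg_tx_delay :: "('nb::finite, 'k) network \<Rightarrow> 'k \<Rightarrow> ennreal" where
  "avg_tx_delay net i =
     (let P = operation_law net (stationary_law net)
      in ennreal (slot_length net) *
           (\<integral>\<^sup>+ \<omega>. waiting_slots net i \<omega> \<partial>uniform_measure P {\<omega> \<in> space P. transmits net i \<omega> 0}))"

end

theory Submission
  imports Defs
begin

text \<open>If a stochastic matrix fixes a vector, it also fixes its componentwise modulus; under
  irreducibility a fixed vector therefore has constant sign, so that fixed vectors with zero sum
  vanish. Hence \<open>A\<^sup>T - E + Q\<close> is injective, and its preimage of \<open>b\<close> is the stationary law.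
  The delay is Kac's recurrence formula: in the stationary regime the events
  ``transmission in slot 0 and none in slots \<open>1, \<dots>, n\<close>'' have probabilities that telescope to
  the probability of ever transmitting. The latter is 1, since by irreducibility every state leads
  to the state with full storages, where each source is selected with positive probability.\<close>

subsection \<open>Fixed vectors of irreducible stochastic matrices\<close>

lemma matrix_inv_inverse:
  fixes M :: "'a::semiring_1 ^ 'n ^ 'm"
  assumes "invertible M"
  shows "M ** matrix_inv M = mat 1 \<and> matrix_inv M ** M = mat 1"
  using assms unfolding invertible_def matrix_inv_def by (rule someI_ex)

lemma stationary_component:
  fixes A :: "real ^ 'n ^ 'n::finite"
  shows "(transpose A *v z) $ q = (\<Sum>p\<in>UNIV. A $ p $ q * z $ p)"
  by (simp add: matrix_vector_mult_def transpose_def)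

text \<open>Conservation of total mass: after swapping the sums, only the row sums of
  \<open>A\<close> remain, and these are 1.\<close>

lemma row_stochastic_sum_transpose:
  fixes A :: "real ^ 'n ^ 'n::finite"
  assumes "row_stochastic A"
  shows "(\<Sum>q\<in>UNIV. (transpose A *v z) $ q) = (\<Sum>p\<in>UNIV. z $ p)"
proof -
  have "(\<Sum>q\<in>UNIV. (transpose A *v z) $ q) = (\<Sum>p\<in>UNIV. \<Sum>q\<in>UNIV. A $ p $ q * z $ p)"
    unfolding stationary_component by (rule sum.swap)
  also have "\<dots> = (\<Sum>p\<in>UNIV. z $ p)"
    using assms by (simp add: row_stochastic_def flip: sum_distrib_right)
  finally show ?thesis .
qed

text \<open>The triangle inequality makes the modulus componentwise at most its image under
  \<open>transpose A\<close>. Both vectors have the same total mass, so the nonnegative differences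
  sum to zero and all vanish.\<close>

lemma row_stochastic_fixed_abs:
  fixes A :: "real ^ 'n ^ 'n::finite"
  assumes "row_stochastic A" and z: "transpose A *v z = z"
  shows "transpose A *v (\<chi> p. \<bar>z $ p\<bar>) = (\<chi> p. \<bar>z $ p\<bar>)"
proof -
  let ?w = "\<chi> p. \<bar>z $ p\<bar>"
  have le: "?w $ q \<le> (transpose A *v ?w) $ q" for q
  proof -
    have "\<bar>z $ q\<bar> = \<bar>\<Sum>p\<in>UNIV. A $ p $ q * z $ p\<bar>"
      using z stationary_component[of A z q] by simp
    also have "\<dots> \<le> (\<Sum>p\<in>UNIV. \<bar>A $ p $ q * z $ p\<bar>)"
      by (rule sum_abs)
    also have "\<dots> = (transpose A *v ?w) $ q"
      using assms(1)
      by (simp add: stationary_component abs_mult row_stochastic_def del: transpose_matrix_vector)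
    finally show ?thesis by simp
  qed
  have "(\<Sum>q\<in>UNIV. (transpose A *v ?w) $ q - ?w $ q) = 0"
    by (simp add: sum_subtractf row_stochastic_sum_transpose[OF assms(1)] del: transpose_matrix_vector)
  then have "(transpose A *v ?w) $ q - ?w $ q = 0" for q
    using le by (subst (asm) sum_nonneg_eq_0_iff) auto
  then show ?thesis by (simp add: vec_eq_iff)
qed

text \<open>Irreducibility in the form used below: a nonempty set of indices closed under one-step
  transitions is everything, by induction along a path.\<close>

lemma irreducible_matrix_closed:
  assumes "irreducible_matrix A" "p \<in> X" and "\<And>p q. p \<in> X \<Longrightarrow> A $ p $ q \<noteq> 0 \<Longrightarrow> q \<in> X"
  shows "q \<in> X"
proof -
  have "(p, q) \<in> {(p, q). A $ p $ q \<noteq> 0}\<^sup>*"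
    using assms(1) by (simp add: irreducible_matrix_def)
  then show ?thesis
    by induction (use assms in auto)
qed

text \<open>The support of \<open>z\<close> is closed under transitions: the single term
  \<open>A $ p $ q * z $ p\<close> already makes the sum for \<open>z $ q\<close> positive, as no
  term is negative.\<close>

lemma fixed_nonneg_pos:
  fixes A :: "real ^ 'n ^ 'n::finite"
  assumes A: "row_stochastic A" "irreducible_matrix A" and z: "transpose A *v z = z"
    and nn: "\<And>p. z $ p \<ge> 0" and "z $ p > 0"
  shows "z $ q > 0"
proof -
  have "q \<in> {q. z $ q > 0}"
  proof (rule irreducible_matrix_closed[OF A(2), of p])
    fix p q assume "p \<in> {q. z $ q > 0}" "A $ p $ q \<noteq> 0"
    then have "0 < A $ p $ q * z $ p"
      using A(1) by (auto simp: row_stochastic_def less_le)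
    also have "\<dots> \<le> (\<Sum>p\<in>UNIV. A $ p $ q * z $ p)"
      using A(1) nn by (intro member_le_sum) (auto simp: row_stochastic_def)
    also have "\<dots> = z $ q"
      using z stationary_component[of A z q] by simp
    finally show "q \<in> {q. z $ q > 0}" by simp
  qed (use assms in simp)
  then show ?thesis by simp
qed

text \<open>Apply the nonnegative case to the fixed vector \<open>z + \<bar>z\<bar>\<close>.\<close>

lemma fixed_pos:
  fixes A :: "real ^ 'n ^ 'n::finite"
  assumes A: "row_stochastic A" "irreducible_matrix A" and z: "transpose A *v z = z"
    and p: "z $ p > 0"
  shows "z $ q > 0"
proof -
  define w where "w = z + (\<chi> p. \<bar>z $ p\<bar>)"
  have "transpose A *v w = w"
    using z row_stochastic_fixed_abs[OF A(1) z] by (simp add: w_def matrix_vector_right_distrib)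
  then have "w $ q > 0"
    by (rule fixed_nonneg_pos[OF A, where p = p]) (use p in \<open>auto simp: w_def\<close>)
  \<comment> \<open>A number plus its modulus is positive only if the number itself is.\<close>
  then show ?thesis by (simp add: w_def)
qed

text \<open>A nonzero component is positive in \<open>z\<close> or in \<open>- z\<close>. That sign
  spreads to all components, which contradicts a vanishing sum.\<close>

lemma fixed_sum_zero:
  fixes A :: "real ^ 'n ^ 'n::finite"
  assumes A: "row_stochastic A" "irreducible_matrix A" and z: "transpose A *v z = z"
    and s: "(\<Sum>p\<in>UNIV. z $ p) = 0"
  shows "z = 0"
proof (rule ccontr)
  assume "z \<noteq> 0"
  then obtain p where "z $ p \<noteq> 0" by (auto simp: vec_eq_iff)
  then consider "z $ p > 0" | "(- z) $ p > 0" by fastforce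
  then show False
  proof cases
    case 1
    have "(\<Sum>p\<in>UNIV. z $ p) > 0"
      by (rule sum_pos) (use fixed_pos[OF A z 1] in auto)
    then show False using s by simp
  next
    case 2
    have "transpose A *v (- z) = - z"
      using z by (simp add: vec.neg)
    then have "(\<Sum>p\<in>UNIV. (- z) $ p) > 0"
      by (intro sum_pos) (use fixed_pos[OF A _ 2] in auto)
    then show False using s by (simp add: sum_negf)
  qed
qed

lemma stationary_solution_pos:
  fixes A :: "real ^ 'n ^ 'n::finite"
  assumes A: "row_stochastic A" "irreducible_matrix A"
    and z: "transpose A *v z = z" "(\<Sum>p\<in>UNIV. z $ p) = 1"
  shows "z $ q > 0"
proof -
  obtain p where "z $ p > 0"
    using z(2) sum_nonpos[of UNIV "\<lambda>p. z $ p"] by (metis not_less zero_less_one)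
  then show ?thesis by (rule fixed_pos[OF A z(1)])
qed

section \<open>Balance equations and normalization as one linear system\<close>

context
  fixes A Q :: "real ^ 'n ^ 'n::finite" and b :: "real ^ 'n"
  assumes A: "row_stochastic A" "irreducible_matrix A"
    and Q: "Q = (\<chi> p q. 1)" and b: "b = (\<chi> p. 1)"
begin

lemma stationary_system_component:
  "((transpose A - mat 1 + Q) *v z) $ q = (transpose A *v z) $ q - z $ q + (\<Sum>p\<in>UNIV. z $ p)"
  by (simp add: matrix_vector_mult_add_rdistrib matrix_vector_mult_diff_rdistrib Q)
     (simp add: matrix_vector_mult_def)

text \<open>Summing all equations cancels the part \<open>transpose A - mat 1\<close> by
  conservation of mass. The right-hand side of the system therefore determines the total mass of
  \<open>z\<close>.\<close>

lemma stationary_system_sum: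
  "(\<Sum>q\<in>UNIV. ((transpose A - mat 1 + Q) *v z) $ q) = real CARD('n) * (\<Sum>p\<in>UNIV. z $ p)"
  by (simp add: stationary_system_component sum.distrib sum_subtractf
      row_stochastic_sum_transpose[OF A(1)] del: transpose_matrix_vector)

text \<open>Trivial kernel suffices for a square matrix. A kernel vector has total mass zero, so the
  term from \<open>Q\<close> disappears and a fixed vector with zero sum is left.\<close>

lemma stationary_system_invertible: "invertible (transpose A - mat 1 + Q)"
proof -
  have "z = 0" if z: "(transpose A - mat 1 + Q) *v z = 0" for z
  proof -
    have s: "(\<Sum>p\<in>UNIV. z $ p) = 0"
      using stationary_system_sum[of z] z by simp
    have "transpose A *v z = z"
      unfolding vec_eq_iff using stationary_system_component[of z] s z by simp
    then show ?thesis by (rule fixed_sum_zero[OF A _ s])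
  qed
  then show ?thesis
    unfolding invertible_left_inverse matrix_left_invertible_ker by blast
qed

text \<open>The all-ones right-hand side forces total mass 1; then \<open>Q *v z\<close> equals
  \<open>b\<close>, and cancelling it leaves the balance equations.\<close>

lemma stationary_system_iff:
  "(transpose A - mat 1 + Q) *v z = b \<longleftrightarrow> transpose A *v z = z \<and> (\<Sum>p\<in>UNIV. z $ p) = 1"
proof
  assume z: "(transpose A - mat 1 + Q) *v z = b"
  have s: "(\<Sum>p\<in>UNIV. z $ p) = 1"
    using stationary_system_sum[of z] z by (simp add: b)
  then show "transpose A *v z = z \<and> (\<Sum>p\<in>UNIV. z $ p) = 1"
    unfolding vec_eq_iff using stationary_system_component[of z] z by (simp add: b)
next
  assume "transpose A *v z = z \<and> (\<Sum>p\<in>UNIV. z $ p) = 1"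
  then show "(transpose A - mat 1 + Q) *v z = b"
    unfolding vec_eq_iff stationary_system_component by (simp add: b)
qed

lemma stationary_system_solution:
  "(transpose A - mat 1 + Q) *v z = b \<longleftrightarrow> z = matrix_inv (transpose A - mat 1 + Q) *v b"
  using matrix_inv_inverse[OF stationary_system_invertible]
  by (metis matrix_vector_mul_assoc matrix_vector_mul_lid)

end

text \<open>Here \<open>v n\<close> collects the row sums of the \<open>n\<close>-th power of
  \<open>B\<close>, later the probabilities of surviving \<open>n\<close> steps. They decrease to a
  limit \<open>u\<close> fixed by \<open>B\<close>. A maximum principle along the transitions of
  \<open>A\<close> carries the maximum of \<open>u\<close> to the deficient row \<open>p0\<close>,
  where it can only be 0.\<close>

lemma substochastic_power_tendsto_0:
  fixes A B :: "real ^ 'n ^ 'n::finite" and v :: "nat \<Rightarrow> real ^ 'n"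
  assumes A: "row_stochastic A" "irreducible_matrix A"
    and B: "\<And>p q. 0 \<le> B $ p $ q" "\<And>p q. B $ p $ q \<le> A $ p $ q"
    and p0: "(\<Sum>q\<in>UNIV. B $ p0 $ q) < 1"
    and v0: "v 0 = (\<chi> p. 1)" and vSuc: "\<And>n. v (Suc n) = B *v v n"
  shows "(\<lambda>n. v n $ p) \<longlonglongrightarrow> 0"
proof -
  have Sv: "v (Suc n) $ p = (\<Sum>q\<in>UNIV. B $ p $ q * v n $ q)" for n p
    by (simp add: vSuc matrix_vector_mult_def)
  have nn: "0 \<le> v n $ p" for n p
    by (induction n arbitrary: p) (auto simp: v0 Sv intro!: sum_nonneg mult_nonneg_nonneg B)
  have B1: "(\<Sum>q\<in>UNIV. B $ p $ q) \<le> 1" for p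
    using sum_mono[of UNIV "\<lambda>q. B $ p $ q" "\<lambda>q. A $ p $ q"] B A(1)
    by (simp add: row_stochastic_def)
  have dec: "v (Suc n) $ p \<le> v n $ p" for n p
  proof (induction n arbitrary: p)
    case 0
    then show ?case using B1 by (simp add: Sv v0)
  next
    case (Suc n)
    then show ?case unfolding Sv[of "Suc n"] Sv[of n] by (intro sum_mono mult_left_mono B)
  qed
  have "convergent (\<lambda>n. v n $ p)" for p
  proof (rule Bseq_monoseq_convergent)
    have d: "decseq (\<lambda>n. v n $ p)" using dec by (intro decseq_SucI) auto
    then show "monoseq (\<lambda>n. v n $ p)" by (rule decseq_imp_monoseq)
    show "Bseq (\<lambda>n. v n $ p)"
      using d nn by (auto simp: decseq_def intro!: BseqI'[where K = "v 0 $ p"])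
  qed
  then obtain u where u: "\<And>p. (\<lambda>n. v n $ p) \<longlonglongrightarrow> u p"
    unfolding convergent_def by metis
  have u_nn: "0 \<le> u p" for p
    by (rule LIMSEQ_le_const[OF u]) (use nn in auto)
  have u_eq: "u p = (\<Sum>q\<in>UNIV. B $ p $ q * u q)" for p
  proof (rule LIMSEQ_unique)
    show "(\<lambda>n. v (Suc n) $ p) \<longlonglongrightarrow> u p" using u by (rule LIMSEQ_Suc)
    show "(\<lambda>n. v (Suc n) $ p) \<longlonglongrightarrow> (\<Sum>q\<in>UNIV. B $ p $ q * u q)"
      unfolding Sv by (intro tendsto_intros u)
  qed
  define m where "m = Max (range u)"
  have u_le: "u q \<le> m" for q by (simp add: m_def)
  have "m \<in> range u" unfolding m_def by (rule Max_in) auto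
  then obtain p1 where p1: "u p1 = m" by auto
  have "p0 \<in> {p. u p = m}"
  proof (rule irreducible_matrix_closed[OF A(2), of p1])
    fix p q assume p: "p \<in> {p. u p = m}" and q: "A $ p $ q \<noteq> 0"
    have "(\<Sum>q\<in>UNIV. B $ p $ q * u q) \<le> (\<Sum>q\<in>UNIV. A $ p $ q * u q)"
      by (intro sum_mono mult_right_mono B u_nn)
    then have "m \<le> (\<Sum>q\<in>UNIV. A $ p $ q * u q)"
      using u_eq[of p] p by simp
    \<comment> \<open>By the previous inequality this sum of nonnegative terms is at most 0, so
      \<open>u q = m\<close> wherever \<open>A $ p $ q\<close> is positive.\<close>
    moreover have "(\<Sum>q\<in>UNIV. A $ p $ q * (m - u q)) = m - (\<Sum>q\<in>UNIV. A $ p $ q * u q)"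
      using A(1) by (simp add: right_diff_distrib sum_subtractf row_stochastic_def
          flip: sum_distrib_right)
    moreover have "A $ p $ q * (m - u q) \<le> (\<Sum>q\<in>UNIV. A $ p $ q * (m - u q))"
      using A(1) u_le by (intro member_le_sum) (auto simp: row_stochastic_def)
    moreover have "0 < A $ p $ q"
      using A(1) q by (auto simp: row_stochastic_def less_le)
    ultimately show "q \<in> {p. u p = m}"
      using u_le[of q] by (smt (verit) mem_Collect_eq mult_pos_pos)
  qed (use p1 in simp)
  \<comment> \<open>The factor is strictly below 1, which is incompatible with a positive
    \<open>m\<close>.\<close>
  then have "m \<le> (\<Sum>q\<in>UNIV. B $ p0 $ q) * m"
    using u_eq[of p0] u_le by (auto simp: sum_distrib_right intro!: sum_mono mult_left_mono B)
  moreover have "0 \<le> m" using u_nn[of p1] p1 by simp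
  ultimately have "m = 0"
    using p0 mult_strict_right_mono[OF p0, of m] by linarith
  then have "u p = 0" using u_le[of p] u_nn[of p] by simp
  then show ?thesis using u[of p] by simp
qed


subsection \<open>Return times of random dynamical systems\<close>

text \<open>Tail-sum formula: the first event time counts the \<open>n\<close>, starting from 0, for
  which slots \<open>1..n\<close> are free of events. In this form the waiting time can be
  integrated term by term.\<close>

lemma INF_of_nat_eq_suminf:
  "(INF t\<in>{t. 0 < t \<and> P t}. of_nat t :: ennreal) =
     (\<Sum>n. if \<forall>t. 0 < t \<and> t \<le> n \<longrightarrow> \<not> P t then 1 else 0)"
proof (cases "\<exists>t>0. P t")
  case True
  define m where "m = (LEAST t. 0 < t \<and> P t)"
  have m: "0 < m" "P m"
    using True LeastI_ex[of "\<lambda>t. 0 < t \<and> P t"] by (auto simp: m_def)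
  have least: "m \<le> t" if "0 < t" "P t" for t
    using that unfolding m_def by (intro Least_le) auto
  have "(\<forall>t. 0 < t \<and> t \<le> n \<longrightarrow> \<not> P t) \<longleftrightarrow> n < m" for n
    using m least by (meson leI less_le_trans not_le)
  then have "(\<Sum>n. if \<forall>t. 0 < t \<and> t \<le> n \<longrightarrow> \<not> P t then 1 else 0 :: ennreal) =
      (\<Sum>n. if n < m then 1 else 0)"
    by simp
  also have "\<dots> = (\<Sum>n\<in>{..<m}. if n < m then 1 else 0)"
    by (rule suminf_finite) auto
  also have "\<dots> = of_nat m" by simp
  also have "of_nat m = (INF t\<in>{t. 0 < t \<and> P t}. of_nat t :: ennreal)"
    by (intro antisym INF_greatest INF_lower2[of m]) (use m least in auto)
  finally show ?thesis ..
next
  case False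
  then have "{t. 0 < t \<and> P t} = {}" "\<And>n. (\<forall>t. 0 < t \<and> t \<le> n \<longrightarrow> \<not> P t) \<longleftrightarrow> True"
    by blast+
  \<comment> \<open>Without any event the series diverges, matching the infimum of the empty set in
    \<open>ennreal\<close>.\<close>
  moreover have "(\<Sum>n. 1 :: ennreal) = \<top>"
    by (simp add: suminf_eq_SUP ennreal_SUP_of_nat_eq_top)
  ultimately show ?thesis by (simp only: if_True) simp
qed

text \<open>Iterated random maps with independent noise, abstracted from the network:
  \<open>x\<close> plays the role of the channel realization of a slot and \<open>T\<close> of a
  transmission. Countability of the state type lets measurability be checked one state at a
  time.\<close>

locale random_dynamics = prob_space M for M :: "'x measure" +
  fixes f :: "'s::countable \<Rightarrow> 'x \<Rightarrow> 's" and T :: "'s \<Rightarrow> 'x \<Rightarrow> bool" and \<Theta> :: "'s set"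
  assumes f_measurable [measurable]: "f s \<in> M \<rightarrow>\<^sub>M count_space UNIV"
    and T_measurable [measurable]: "Measurable.pred M (T s)"
    and finite_\<Theta>: "finite \<Theta>"
    and closed: "\<lbrakk>s \<in> \<Theta>; x \<in> space M\<rbrakk> \<Longrightarrow> f s x \<in> \<Theta>"
begin

sublocale Seq: sequence_space M ..

primrec path :: "'s \<Rightarrow> (nat \<Rightarrow> 'x) \<Rightarrow> nat \<Rightarrow> 's" where
  "path s h 0 = s"
| "path s h (Suc t) = f (path s h t) (h t)"

text \<open>The recursion of \<open>path\<close> appends the last step; this removes the first one
  instead, as the Markov property requires.\<close>

lemma path_case_nat: "path s (case_nat x h) (Suc t) = path (f s x) h t"
  by (induction t) auto

definition quiet :: "nat \<Rightarrow> 's \<Rightarrow> (nat \<Rightarrow> 'x) \<Rightarrow> bool" where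
  "quiet n s h \<longleftrightarrow> (\<forall>t<n. \<not> T (path s h t) (h t))"

text \<open>The silent slots are \<open>1..n\<close>, not \<open>0..n-1\<close> as in
  \<open>quiet\<close>. Once slot 0 is split off, what remains is exactly \<open>quiet n\<close>
  from the next state.\<close>

definition returns_after :: "nat \<Rightarrow> 's \<Rightarrow> (nat \<Rightarrow> 'x) \<Rightarrow> bool" where
  "returns_after n s h \<longleftrightarrow> T s (h 0) \<and> (\<forall>t. 0 < t \<and> t \<le> n \<longrightarrow> \<not> T (path s h t) (h t))"

lemma quiet_case_nat: "quiet (Suc n) s (case_nat x h) \<longleftrightarrow> \<not> T s x \<and> quiet n (f s x) h"
  unfolding quiet_def All_less_Suc2 path_case_nat by simp

lemma returns_after_case_nat: "returns_after n s (case_nat x h) \<longleftrightarrow> T s x \<and> quiet n (f s x) h"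
proof -
  have "(\<forall>t. 0 < t \<and> t \<le> n \<longrightarrow> P t) \<longleftrightarrow> (\<forall>t<n. P (Suc t))" for P
    by (metis Suc_le_eq Suc_pred zero_less_Suc)
  then show ?thesis
    by (simp add: quiet_def returns_after_def path_case_nat del: path.simps(2))
qed

lemma measurable_comp_path [measurable]:
  "(\<lambda>h. path s h t) \<in> Seq.S \<rightarrow>\<^sub>M count_space UNIV"
proof (induction t)
  case (Suc t)
  have "(\<lambda>h. f (path s h t) (h t)) \<in> Seq.S \<rightarrow>\<^sub>M count_space UNIV"
    by (rule measurable_compose_countable[OF _ Suc]) measurable
  then show ?case by simp
qed simp

lemma measurable_T_path [measurable]: "Measurable.pred Seq.S (\<lambda>h. T (path s h t) (h t))"
  by (rule measurable_compose_countable[OF _ measurable_comp_path]) measurable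

lemma measurable_quiet [measurable]: "Measurable.pred Seq.S (quiet n s)"
  unfolding quiet_def[abs_def] by measurable

lemma measurable_returns_after [measurable]: "Measurable.pred Seq.S (returns_after n s)"
  unfolding returns_after_def[abs_def] by measurable

text \<open>The Markov property. Prepending an independent draw from \<open>M\<close> to a noise
  sequence reproduces the law of the sequence, so first step and continuation are independent given
  the successor \<open>s'\<close>.\<close>

lemma first_step_decomposition:
  assumes [measurable]: "Measurable.pred Seq.S F" "Measurable.pred M P"
      "\<And>s. Measurable.pred Seq.S (E s)"
    and s: "s \<in> \<Theta>" and F: "\<And>x h. F (case_nat x h) \<longleftrightarrow> P x \<and> E (f s x) h"
  shows "\<P>(h in Seq.S. F h) = (\<Sum>s'\<in>\<Theta>. \<P>(x in M. P x \<and> f s x = s') * \<P>(h in Seq.S. E s' h))"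
proof -
  let ?C = "\<lambda>s'. {x \<in> space M. P x \<and> f s x = s'} \<times> {h \<in> space Seq.S. E s' h}"
  have "emeasure Seq.S {h \<in> space Seq.S. F h} =
      emeasure (distr (M \<Otimes>\<^sub>M Seq.S) Seq.S (\<lambda>(s, \<omega>). case_nat s \<omega>)) {h \<in> space Seq.S. F h}"
    by (simp only: Seq.PiM_iter)
  also have "\<dots> = emeasure (M \<Otimes>\<^sub>M Seq.S)
      ((\<lambda>(s, \<omega>). case_nat s \<omega>) -` {h \<in> space Seq.S. F h} \<inter> space (M \<Otimes>\<^sub>M Seq.S))"
    by (rule emeasure_distr) measurable
  \<comment> \<open>Splitting by the successor turns the event into a disjoint union of rectangles;
    \<open>closed\<close> guarantees that the successors in \<open>\<Theta>\<close> exhaust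
    it.\<close>
  also have "(\<lambda>(s, \<omega>). case_nat s \<omega>) -` {h \<in> space Seq.S. F h} \<inter> space (M \<Otimes>\<^sub>M Seq.S) =
      (\<Union>s'\<in>\<Theta>. ?C s')"
    using closed[OF s] by (auto simp: F space_pair_measure space_PiM PiE_iff split: nat.splits)
  also have "emeasure (M \<Otimes>\<^sub>M Seq.S) (\<Union>s'\<in>\<Theta>. ?C s') =
      (\<Sum>s'\<in>\<Theta>. emeasure (M \<Otimes>\<^sub>M Seq.S) (?C s'))"
    by (rule sum_emeasure[symmetric]) (auto simp: disjoint_family_on_def finite_\<Theta>)
  also have "\<dots> = (\<Sum>s'\<in>\<Theta>. ennreal (\<P>(x in M. P x \<and> f s x = s') * \<P>(h in Seq.S. E s' h)))"
    by (intro sum.cong refl, subst Seq.P.emeasure_pair_measure_Times)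
       (auto simp: emeasure_eq_measure Seq.P.emeasure_eq_measure ennreal_mult)
  also have "\<dots> = ennreal (\<Sum>s'\<in>\<Theta>. \<P>(x in M. P x \<and> f s x = s') * \<P>(h in Seq.S. E s' h))"
    by (rule sum_ennreal) simp
  finally show ?thesis
    by (simp add: Seq.P.emeasure_eq_measure sum_nonneg)
qed

lemma sum_prob_step:
  assumes [measurable]: "Measurable.pred M P" and s: "s \<in> \<Theta>"
  shows "(\<Sum>s'\<in>\<Theta>. \<P>(x in M. P x \<and> f s x = s')) = \<P>(x in M. P x)"
proof -
  have "\<P>(x in M. P x) = prob (\<Union>s'\<in>\<Theta>. {x \<in> space M. P x \<and> f s x = s'})"
    using closed[OF s] by (intro arg_cong[where f = prob]) auto
  also have "\<dots> = (\<Sum>s'\<in>\<Theta>. \<P>(x in M. P x \<and> f s x = s'))"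
    by (rule finite_measure_finite_Union) (auto simp: finite_\<Theta> disjoint_family_on_def)
  finally show ?thesis ..
qed

lemma prob_quiet_0: "\<P>(h in Seq.S. quiet 0 s h) = 1"
  using Seq.P.prob_space by (simp add: quiet_def)

lemma prob_quiet_Suc:
  assumes "s \<in> \<Theta>"
  shows "\<P>(h in Seq.S. quiet (Suc n) s h) =
    (\<Sum>s'\<in>\<Theta>. \<P>(x in M. \<not> T s x \<and> f s x = s') * \<P>(h in Seq.S. quiet n s' h))"
  by (rule first_step_decomposition[where P = "\<lambda>x. \<not> T s x" and E = "quiet n"])
     (simp_all add: assms quiet_case_nat)

lemma prob_returns_after:
  assumes "s \<in> \<Theta>"
  shows "\<P>(h in Seq.S. returns_after n s h) =
    (\<Sum>s'\<in>\<Theta>. \<P>(x in M. T s x \<and> f s x = s') * \<P>(h in Seq.S. quiet n s' h))"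
  by (rule first_step_decomposition[where P = "T s" and E = "quiet n"])
     (simp_all add: assms returns_after_case_nat)

lemma prob_split_T:
  "\<P>(x in M. f s x = s') = \<P>(x in M. T s x \<and> f s x = s') + \<P>(x in M. \<not> T s x \<and> f s x = s')"
  by (subst finite_measure_Union[symmetric]) (auto intro!: arg_cong[where f = prob])

definition waiting :: "'s \<times> (nat \<Rightarrow> 'x) \<Rightarrow> ennreal" where
  "waiting \<omega> = (INF t\<in>{t. 0 < t \<and> T (path (fst \<omega>) (snd \<omega>) t) (snd \<omega> t)}. of_nat t)"

text \<open>Kac's recurrence formula. By stationarity the probability that the first return to \<open>T\<close>
  takes more than \<open>n\<close> steps is the difference of the probabilities of no visit during \<open>n\<close> and
  during \<open>n + 1\<close> slots, so the expected return time telescopes.\<close>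

context
  fixes \<nu> :: "'s pmf"
  assumes \<nu>_\<Theta>: "set_pmf \<nu> \<subseteq> \<Theta>"
    and \<nu>_stationary: "\<And>s'. s' \<in> \<Theta> \<Longrightarrow> pmf \<nu> s' = (\<Sum>s\<in>\<Theta>. \<P>(x in M. f s x = s') * pmf \<nu> s)"
    and quiet_0: "\<And>s. s \<in> \<Theta> \<Longrightarrow> (\<lambda>n. \<P>(h in Seq.S. quiet n s h)) \<longlonglongrightarrow> 0"
begin

text \<open>The first factor carries the discrete sigma-algebra on a countable type, so joint
  measurability follows from that of the sections.\<close>

lemma measurable_stationary_pair:
  assumes "\<And>s. (\<lambda>h. g (s, h)) \<in> borel_measurable Seq.S"
  shows "(g :: _ \<Rightarrow> ennreal) \<in> borel_measurable (measure_pmf \<nu> \<Otimes>\<^sub>M Seq.S)"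
proof -
  have "g \<in> borel_measurable (count_space UNIV \<Otimes>\<^sub>M Seq.S)"
    by (rule measurable_pair_measure_countable1) (use assms in auto)
  then show ?thesis
    by (simp cong: measurable_cong_sets sets_pair_measure_cong)
qed

lemma sets_stationary_T:
  "{\<omega> \<in> space (measure_pmf \<nu> \<Otimes>\<^sub>M Seq.S). T (fst \<omega>) (snd \<omega> 0)} \<in> sets (measure_pmf \<nu> \<Otimes>\<^sub>M Seq.S)"
proof -
  let ?P = "measure_pmf \<nu> \<Otimes>\<^sub>M Seq.S"
  \<comment> \<open>The event is expressed as a level set of an indicator so that the criterion for
    functions applies.\<close>
  have "(\<lambda>\<omega>. indicator (Collect (T (fst \<omega>))) (snd \<omega> 0) :: ennreal) \<in> borel_measurable ?P"
    by (rule measurable_stationary_pair) (simp add: indicator_def)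
  then have "(\<lambda>\<omega>. indicator (Collect (T (fst \<omega>))) (snd \<omega> 0) :: ennreal) -` {1} \<inter> space ?P \<in> sets ?P"
    by (rule measurable_sets) simp
  also have "(\<lambda>\<omega>. indicator (Collect (T (fst \<omega>))) (snd \<omega> 0) :: ennreal) -` {1} \<inter> space ?P =
      {\<omega> \<in> space ?P. T (fst \<omega>) (snd \<omega> 0)}"
    by (auto simp: indicator_def)
  finally show ?thesis .
qed

lemma measurable_waiting: "waiting \<in> borel_measurable (measure_pmf \<nu> \<Otimes>\<^sub>M Seq.S)"
  unfolding waiting_def INF_of_nat_eq_suminf by (rule measurable_stationary_pair) simp

text \<open>Fubini, followed by summation over the finite set \<open>\<Theta>\<close> that supports
  \<open>\<nu>\<close>.\<close>

lemma nn_integral_stationary_pair: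
  assumes [measurable]: "\<And>s. Measurable.pred Seq.S (E s)"
  shows "(\<integral>\<^sup>+\<omega>. (if E (fst \<omega>) (snd \<omega>) then 1 else 0) \<partial>(measure_pmf \<nu> \<Otimes>\<^sub>M Seq.S)) =
    ennreal (\<Sum>s\<in>\<Theta>. pmf \<nu> s * \<P>(h in Seq.S. E s h))"
proof -
  have [measurable]: "(\<lambda>\<omega>. if E (fst \<omega>) (snd \<omega>) then 1 else 0 :: ennreal)
      \<in> borel_measurable (measure_pmf \<nu> \<Otimes>\<^sub>M Seq.S)"
    by (rule measurable_stationary_pair) simp
  have "(\<integral>\<^sup>+\<omega>. (if E (fst \<omega>) (snd \<omega>) then 1 else 0) \<partial>(measure_pmf \<nu> \<Otimes>\<^sub>M Seq.S)) =
      (\<integral>\<^sup>+s. \<integral>\<^sup>+h. (if E s h then 1 else 0) \<partial>Seq.S \<partial>measure_pmf \<nu>)"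
    by (subst Seq.P.nn_integral_fst[symmetric]) simp_all
  also have "\<dots> = (\<integral>\<^sup>+s. ennreal (\<P>(h in Seq.S. E s h)) \<partial>measure_pmf \<nu>)"
  proof (rule nn_integral_cong)
    fix s
    have "(\<integral>\<^sup>+h. (if E s h then 1 else 0) \<partial>Seq.S) =
        (\<integral>\<^sup>+h. indicator {h \<in> space Seq.S. E s h} h \<partial>Seq.S)"
      by (rule nn_integral_cong) (simp add: indicator_def)
    then show "(\<integral>\<^sup>+h. (if E s h then 1 else 0) \<partial>Seq.S) = ennreal (\<P>(h in Seq.S. E s h))"
      by (simp add: Seq.P.emeasure_eq_measure)
  qed
  also have "\<dots> = (\<Sum>s\<in>\<Theta>. ennreal (\<P>(h in Seq.S. E s h)) * ennreal (pmf \<nu> s))"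
    by (rule nn_integral_measure_pmf_support) (use finite_\<Theta> \<nu>_\<Theta> in auto)
  also have "\<dots> = ennreal (\<Sum>s\<in>\<Theta>. pmf \<nu> s * \<P>(h in Seq.S. E s h))"
    by (subst sum_ennreal[symmetric]) (auto simp: ennreal_mult mult.commute)
  finally show ?thesis .
qed

text \<open>The first-step expansions of \<open>returns_after n\<close> and
  \<open>quiet (Suc n)\<close> differ only in \<open>T\<close> versus its negation. Added together
  they give the full one-step transition probabilities, which stationarity of \<open>\<nu>\<close>
  absorbs.\<close>

lemma stationary_prob_returns_after:
  "(\<Sum>s\<in>\<Theta>. pmf \<nu> s * \<P>(h in Seq.S. returns_after n s h)) =
   (\<Sum>s\<in>\<Theta>. pmf \<nu> s * \<P>(h in Seq.S. quiet n s h)) -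
   (\<Sum>s\<in>\<Theta>. pmf \<nu> s * \<P>(h in Seq.S. quiet (Suc n) s h))"
proof -
  let ?V = "\<lambda>s. \<P>(h in Seq.S. quiet n s h)"
  have "(\<Sum>s\<in>\<Theta>. pmf \<nu> s * \<P>(h in Seq.S. returns_after n s h)) +
      (\<Sum>s\<in>\<Theta>. pmf \<nu> s * \<P>(h in Seq.S. quiet (Suc n) s h)) =
      (\<Sum>s\<in>\<Theta>. \<Sum>s'\<in>\<Theta>. \<P>(x in M. f s x = s') * pmf \<nu> s * ?V s')"
    unfolding sum.distrib[symmetric]
    by (intro sum.cong refl, simp only: prob_returns_after prob_quiet_Suc prob_split_T)
       (simp add: sum_distrib_left sum.distrib[symmetric] algebra_simps)
  also have "\<dots> = (\<Sum>s'\<in>\<Theta>. pmf \<nu> s' * ?V s')"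
    by (subst sum.swap) (simp add: \<nu>_stationary sum_distrib_right)
  finally show ?thesis by simp
qed

lemma stationary_emeasure_T:
  "emeasure (measure_pmf \<nu> \<Otimes>\<^sub>M Seq.S) {\<omega> \<in> space (measure_pmf \<nu> \<Otimes>\<^sub>M Seq.S). T (fst \<omega>) (snd \<omega> 0)} =
   ennreal (\<Sum>s\<in>\<Theta>. pmf \<nu> s * \<P>(x in M. T s x))"
proof -
  let ?P = "measure_pmf \<nu> \<Otimes>\<^sub>M Seq.S"
  have "emeasure ?P {\<omega> \<in> space ?P. T (fst \<omega>) (snd \<omega> 0)} =
      (\<integral>\<^sup>+\<omega>. indicator {\<omega> \<in> space ?P. T (fst \<omega>) (snd \<omega> 0)} \<omega> \<partial>?P)"
    by (rule nn_integral_indicator[symmetric]) (rule sets_stationary_T)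
  \<comment> \<open>For \<open>n = 0\<close> the silence condition is vacuous, so only the event in
    slot 0 is left.\<close>
  also have "\<dots> = (\<integral>\<^sup>+\<omega>. (if returns_after 0 (fst \<omega>) (snd \<omega>) then 1 else 0) \<partial>?P)"
    by (rule nn_integral_cong) (auto simp: returns_after_def indicator_def)
  also have "\<dots> = ennreal (\<Sum>s\<in>\<Theta>. pmf \<nu> s * \<P>(h in Seq.S. returns_after 0 s h))"
    by (rule nn_integral_stationary_pair) measurable
  also have "\<dots> = ennreal (\<Sum>s\<in>\<Theta>. pmf \<nu> s * \<P>(x in M. T s x))"
    by (simp add: prob_returns_after prob_quiet_0 sum_prob_step)
  finally show ?thesis .
qed

lemma expected_waiting:
  "(\<integral>\<^sup>+\<omega>. waiting \<omega> * indicator {\<omega> \<in> space (measure_pmf \<nu> \<Otimes>\<^sub>M Seq.S). T (fst \<omega>) (snd \<omega> 0)} \<omega>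
     \<partial>(measure_pmf \<nu> \<Otimes>\<^sub>M Seq.S)) = 1"
proof -
  let ?P = "measure_pmf \<nu> \<Otimes>\<^sub>M Seq.S"
  let ?a = "\<lambda>n. \<Sum>s\<in>\<Theta>. pmf \<nu> s * \<P>(h in Seq.S. quiet n s h)"
  have [measurable]: "(\<lambda>\<omega>. if returns_after n (fst \<omega>) (snd \<omega>) then 1 else 0 :: ennreal)
      \<in> borel_measurable ?P" for n
    by (rule measurable_stationary_pair) simp
  have "(\<integral>\<^sup>+\<omega>. waiting \<omega> * indicator {\<omega> \<in> space ?P. T (fst \<omega>) (snd \<omega> 0)} \<omega> \<partial>?P) =
      (\<integral>\<^sup>+\<omega>. (\<Sum>n. if returns_after n (fst \<omega>) (snd \<omega>) then 1 else 0) \<partial>?P)"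
  proof (rule nn_integral_cong)
    fix \<omega> assume "\<omega> \<in> space ?P"
    then show "waiting \<omega> * indicator {\<omega> \<in> space ?P. T (fst \<omega>) (snd \<omega> 0)} \<omega> =
        (\<Sum>n. if returns_after n (fst \<omega>) (snd \<omega>) then 1 else 0)"
      unfolding waiting_def INF_of_nat_eq_suminf returns_after_def
      by (cases "T (fst \<omega>) (snd \<omega> 0)") simp_all
  qed
  also have "\<dots> = (\<Sum>n. \<integral>\<^sup>+\<omega>. (if returns_after n (fst \<omega>) (snd \<omega>) then 1 else 0) \<partial>?P)"
    by (rule nn_integral_suminf) measurable
  also have "\<dots> = (\<Sum>n. ennreal (?a n - ?a (Suc n)))"
    by (subst nn_integral_stationary_pair) (simp_all add: stationary_prob_returns_after)
  also have "\<dots> = ennreal (?a 0)"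
  proof (rule suminf_ennreal_eq)
    show "0 \<le> ?a n - ?a (Suc n)" for n
      unfolding stationary_prob_returns_after[symmetric] by (simp add: sum_nonneg)
    \<comment> \<open>The sum over \<open>\<Theta>\<close> is finite, so the pointwise decay assumed
      in \<open>quiet_0\<close> passes to the average. The telescoping series then retains only
      \<open>?a 0\<close>.\<close>
    have "?a \<longlonglongrightarrow> (\<Sum>s\<in>\<Theta>. pmf \<nu> s * 0)"
      by (intro tendsto_intros quiet_0)
    then show "(\<lambda>n. ?a n - ?a (Suc n)) sums ?a 0"
      using telescope_sums'[of ?a 0] by simp
  qed
  also have "?a 0 = 1"
    using sum_pmf_eq_1[OF finite_\<Theta> \<nu>_\<Theta>] by (simp only: prob_quiet_0 mult_1_right)
  finally show ?thesis by simp
qed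

text \<open>Conditioning divides the integral 1 of the waiting time over the event by the
  probability of that event.\<close>

lemma conditional_expected_waiting:
  "(\<integral>\<^sup>+\<omega>. waiting \<omega> \<partial>uniform_measure (measure_pmf \<nu> \<Otimes>\<^sub>M Seq.S)
      {\<omega> \<in> space (measure_pmf \<nu> \<Otimes>\<^sub>M Seq.S). T (fst \<omega>) (snd \<omega> 0)}) =
   1 / ennreal (\<Sum>s\<in>\<Theta>. pmf \<nu> s * \<P>(x in M. T s x))"
  by (subst nn_integral_uniform_measure[OF measurable_waiting sets_stationary_T])
     (simp only: expected_waiting stationary_emeasure_T)

end

end


subsection \<open>Channels and one slot of the network\<close>

text \<open>A vector is the finite sum of its components placed on the axes, and each placement map
  is continuous.\<close>

lemma measurable_vec_lambda:
  fixes f :: "'a \<Rightarrow> 'm::finite \<Rightarrow> 'b::euclidean_space"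
  assumes [measurable]: "\<And>m. (\<lambda>x. f x m) \<in> borel_measurable M"
  shows "(\<lambda>x. \<chi> m. f x m) \<in> borel_measurable M"
proof -
  have "continuous_on UNIV (\<lambda>x :: 'b. if i = m then x else 0)" for i m :: 'm
    by (cases "i = m") auto
  then have [measurable]: "axis m \<in> borel_measurable (borel :: 'b measure)" for m :: 'm
    unfolding axis_def[abs_def]
    by (intro borel_measurable_continuous_onI continuous_on_vec_lambda)
  have "(\<lambda>x. \<chi> m. f x m) = (\<lambda>x. \<Sum>m\<in>UNIV. axis m (f x m))"
    by (auto simp: fun_eq_iff vec_eq_iff axis_def if_distrib cong: if_cong)
  then show ?thesis by simp
qed

lemma measurable_vec_nth [measurable]:
  "(\<lambda>x :: 'b::euclidean_space ^ 'm::finite. x $ m) \<in> borel_measurable borel"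
  by (intro borel_measurable_continuous_onI continuous_intros)

text \<open>The density is strictly positive everywhere, so a null interval would also be Lebesgue
  null.\<close>

lemma emeasure_normal_density_interval:
  assumes "\<sigma> > 0" "a < b"
  shows "emeasure (density lborel (\<lambda>x. ennreal (normal_density \<mu> \<sigma> x))) {a<..<b} > 0"
proof -
  have "{a<..<b} \<notin> null_sets (density lborel (\<lambda>x. ennreal (normal_density \<mu> \<sigma> x)))"
  proof
    assume "{a<..<b} \<in> null_sets (density lborel (\<lambda>x. ennreal (normal_density \<mu> \<sigma> x)))"
    then have "AE x in lborel. x \<in> {a<..<b} \<longrightarrow> ennreal (normal_density \<mu> \<sigma> x) = 0"
      by (subst (asm) null_sets_density_iff) auto
    then have "AE x in lborel. x \<notin> {a<..<b}"
    proof eventually_elim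
      case (elim x)
      then show ?case using normal_density_pos[OF assms(1), of \<mu> x] by (auto simp: ennreal_eq_0_iff)
    qed
    then have "{a<..<b} \<in> null_sets lborel"
      by (subst (asm) AE_iff_null_sets[symmetric]) auto
    then show False using assms(2) by (auto simp: null_sets_def)
  qed
  then show ?thesis by (auto simp: null_sets_def zero_less_iff_neq_zero)
qed

lemma sets_complex_gaussian [simp, measurable_cong]: "sets (complex_gaussian v) = sets borel"
  by (simp add: complex_gaussian_def Let_def)

lemma space_complex_gaussian [simp]: "space (complex_gaussian v) = UNIV"
  by (simp add: complex_gaussian_def Let_def)

lemma measurable_Complex [measurable]:
  "(\<lambda>(x, y). Complex x y) \<in> borel \<Otimes>\<^sub>M borel \<rightarrow>\<^sub>M borel"
  unfolding Complex_eq split_beta by measurable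

lemma prob_space_complex_gaussian:
  assumes "v > 0"
  shows "prob_space (complex_gaussian v)"
proof -
  define N where "N = density lborel (\<lambda>x. ennreal (normal_density 0 (sqrt (v / 2)) x))"
  have [measurable_cong]: "sets N = sets borel" by (simp add: N_def)
  interpret N: prob_space N
    unfolding N_def using assms by (intro prob_space_normal_density) simp
  interpret NN: pair_prob_space N N ..
  show ?thesis
    unfolding complex_gaussian_def Let_def N_def[symmetric]
    by (intro NN.prob_space_distr) measurable
qed

lemma complex_gaussian_rectangle:
  assumes "v > 0" "a < b"
  shows "emeasure (complex_gaussian v) {z. Re z \<in> {a<..<b} \<and> Im z \<in> {a<..<b}} > 0"
proof -
  define N where "N = density lborel (\<lambda>x. ennreal (normal_density 0 (sqrt (v / 2)) x))"
  have [measurable_cong]: "sets N = sets borel" and [simp]: "space N = UNIV" by (simp_all add: N_def)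
  interpret N: prob_space N
    unfolding N_def using assms by (intro prob_space_normal_density) simp
  have "emeasure (complex_gaussian v) {z. Re z \<in> {a<..<b} \<and> Im z \<in> {a<..<b}} =
      emeasure (N \<Otimes>\<^sub>M N) ({a<..<b} \<times> {a<..<b})"
    unfolding complex_gaussian_def Let_def N_def[symmetric]
    by (subst emeasure_distr) (auto intro!: arg_cong2[where f = emeasure] simp: space_pair_measure)
  also have "\<dots> = emeasure N {a<..<b} * emeasure N {a<..<b}"
    by (intro N.emeasure_pair_measure_Times) auto
  also have "\<dots> > 0"
    using emeasure_normal_density_interval[of "sqrt (v / 2)" a b 0] assms
    by (simp add: N_def[symmetric] ennreal_zero_less_mult_iff)
  finally show ?thesis .
qed

text \<open>The event \<open>quantize net e = n\<close> is spelled out as a finite combination of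
  comparisons of \<open>e\<close> with the level energies.\<close>

lemma measurable_quantize [measurable]: "quantize net \<in> borel \<rightarrow>\<^sub>M count_space UNIV"
proof -
  let ?S = "\<lambda>e. {l \<in> {0..top_level net}. level_energy net l \<le> e}"
  have "(quantize net e = n) \<longleftrightarrow>
      (if \<exists>l\<in>{0..top_level net}. level_energy net l \<le> e
       then n \<in> {0..top_level net} \<and> level_energy net n \<le> e \<and>
         (\<forall>l\<in>{0..top_level net}. level_energy net l \<le> e \<longrightarrow> l \<le> n)
       else n = Max {})" for e n
  proof (cases "\<exists>l\<in>{0..top_level net}. level_energy net l \<le> e")
    case True
    then show ?thesis
      unfolding quantize_def by (subst Max_eq_iff) auto
  next
    case False
    \<comment> \<open>This happens only for negative \<open>e\<close>, since level 0 has energy 0.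
      The value is then the fixed, unspecified number \<open>Max {}\<close>.\<close>
    then have "?S e = {}" by auto
    then show ?thesis
      unfolding quantize_def using False by (simp only: if_False) auto
  qed
  then have "Measurable.pred borel (\<lambda>e. quantize net e = n)" for n
    by simp
  then show ?thesis
    by (subst measurable_count_space_eq2_countable) (auto simp: pred_def vimage_def Int_def conj_commute)
qed

lemma finite_UNIV_link: "finite (UNIV :: ('nb::finite, 'k::finite) link set)"
proof -
  have "(UNIV :: ('nb, 'k) link set) =
      range (\<lambda>(m, k). BS m k) \<union> range BD \<union> range SD \<union> range (\<lambda>(j, k). SS j k)"
  proof (intro set_eqI iffI UNIV_I)
    fix c :: "('nb, 'k) link"
    show "c \<in> range (\<lambda>(m, k). BS m k) \<union> range BD \<union> range SD \<union> range (\<lambda>(j, k). SS j k)"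
      by (cases c) (auto simp: image_iff)
  qed
  then show ?thesis by (metis finite_Un finite_imageI finite_class.finite_UNIV)
qed

definition channels :: "('nb, 'k) link set" where
  "channels = {c. \<forall>k. c \<noteq> SS k k}"

lemma channels_simps [simp]:
  "BS m k \<in> channels" "BD m \<in> channels" "SD k \<in> channels" "SS j k \<in> channels \<longleftrightarrow> j \<noteq> k"
  by (auto simp: channels_def)

lemma mean_gain_pos:
  assumes "valid_network net" "c \<in> channels"
  shows "mean_gain net c > 0"
proof -
  have "distance net a b \<noteq> 0" if "a \<noteq> b" for a b
    using assms(1) that by (force simp: valid_network_def)
  then show ?thesis
    using assms(2) by (cases c) (auto simp: powr_gt_zero)
qed

context
  fixes net :: "('nb::finite, 'k::finite) network"
  assumes net: "valid_network net"
begin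

text \<open>The theory of product probability spaces wants a probability measure at every index, but
  the distance of a source to itself is unconstrained and its \<open>mean_gain\<close> may fail to
  be positive. Outside \<open>channels\<close> the variance is therefore replaced by 1, which leaves
  the product unchanged.\<close>

lemma slot_law_eq:
  "slot_law net = (\<Pi>\<^sub>M c\<in>channels. complex_gaussian (if c \<in> channels then mean_gain net c else 1))"
  unfolding slot_law_def channels_def[symmetric] by (rule PiM_cong) auto

lemma channel_law_prob_space:
  "prob_space (complex_gaussian (if c \<in> channels then mean_gain net c else 1))"
  by (rule prob_space_complex_gaussian) (simp add: mean_gain_pos[OF net])

lemma prob_space_slot_law: "prob_space (slot_law net)"
  unfolding slot_law_eq by (rule prob_space_PiM) (rule channel_law_prob_space)

text \<open>Independence of the finitely many channels turns the measure into a product of positive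
  factors.\<close>

lemma emeasure_slot_law_rectangle:
  assumes "\<And>c. c \<in> channels \<Longrightarrow> a c < b c"
  shows "emeasure (slot_law net)
    (\<Pi>\<^sub>E c\<in>channels. {z. Re z \<in> {a c<..<b c} \<and> Im z \<in> {a c<..<b c}}) > 0"
proof -
  interpret product_prob_space "\<lambda>c. complex_gaussian (if c \<in> channels then mean_gain net c else 1)" channels
    by (rule product_prob_spaceI) (rule channel_law_prob_space)
  have "emeasure (slot_law net)
      (\<Pi>\<^sub>E c\<in>channels. {z. Re z \<in> {a c<..<b c} \<and> Im z \<in> {a c<..<b c}}) =
      (\<Prod>c\<in>channels. emeasure (complex_gaussian (if c \<in> channels then mean_gain net c else 1))
        {z. Re z \<in> {a c<..<b c} \<and> Im z \<in> {a c<..<b c}})"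
    unfolding slot_law_eq
    by (rule emeasure_PiM) (auto intro: finite_subset[OF subset_UNIV finite_UNIV_link])
  also have "\<dots> \<noteq> 0"
    using complex_gaussian_rectangle mean_gain_pos[OF net] assms
    by (auto simp: prod_zero_iff finite_subset[OF subset_UNIV finite_UNIV_link] less_le)
  finally show ?thesis by (simp add: zero_less_iff_neq_zero)
qed

lemma measurable_channel [measurable]:
  "c \<in> channels \<Longrightarrow> (\<lambda>h. h c) \<in> borel_measurable (slot_law net)"
  unfolding slot_law_eq
  by (rule measurable_cong_sets[THEN equalityD1, THEN subsetD, OF refl _ measurable_component_singleton])
     simp_all

text \<open>In case of ties \<open>arg_max\<close> makes an unspecified choice. The choice depends
  only on the set of maximizers, which is a measurable function into a finite discrete
  space.\<close>

lemma measurable_selected [measurable]: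
  "selected net s \<in> slot_law net \<rightarrow>\<^sub>M count_space UNIV"
proof -
  let ?J = "\<lambda>h :: ('nb, 'k) link \<Rightarrow> complex.
    {k. is_arg_max (\<lambda>k. (cmod (h (SD k)))\<^sup>2) (\<lambda>k. k \<in> eligible net s) k}"
  have "Measurable.pred (slot_law net) (\<lambda>h. k \<in> ?J h)" for k
    unfolding is_arg_max_def mem_Collect_eq by measurable
  then have "Measurable.pred (slot_law net) (\<lambda>h. \<forall>k. k \<in> ?J h \<longleftrightarrow> k \<in> X)" for X
    by measurable
  then have "Measurable.pred (slot_law net) (\<lambda>h. ?J h = X)" for X
    by (simp only: set_eq_iff)
  then have "?J \<in> slot_law net \<rightarrow>\<^sub>M count_space UNIV"
    by (subst measurable_count_space_eq2_countable) (auto simp: pred_def vimage_def Int_def conj_commute)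
  then have "(\<lambda>h. if eligible net s = {} then None else Some (SOME k. k \<in> ?J h))
      \<in> slot_law net \<rightarrow>\<^sub>M count_space UNIV"
    by measurable
  then show ?thesis
    unfolding selected_def[abs_def] arg_max_def mem_Collect_eq .
qed

text \<open>The case \<open>sel = Some k\<close> is excluded because it would involve the
  self-channel \<open>SS k k\<close>, which is not a coordinate of \<open>slot_law\<close>.\<close>

lemma measurable_harvested:
  assumes "sel \<noteq> Some k"
  shows "(\<lambda>h. harvested net sel h k) \<in> borel_measurable (slot_law net)"
proof (cases sel)
  case None
  then show ?thesis by (simp add: harvested_def beamformed_def)
next
  case (Some j)
  have [measurable]: "(\<lambda>h. zf_weight net (\<chi> m. h (BD m))) \<in> borel_measurable (slot_law net)"
    by (rule measurable_compose[OF measurable_vec_lambda])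
       (use net in \<open>auto simp: valid_network_def\<close>)
  have [measurable]: "(\<lambda>h. zf_weight net (\<chi> m. h (BD m)) $ m) \<in> borel_measurable (slot_law net)" for m
    by measurable
  have "SS j k \<in> channels" using Some assms by simp
  then show ?thesis using Some by (simp add: harvested_def beamformed_def)
qed

text \<open>Measurability is shown for each fixed selection and then composed over the countably
  many selections. The selected source does not harvest, so the excluded self-channel never
  enters.\<close>

lemma measurable_next_state [measurable]:
  "next_state net s \<in> slot_law net \<rightarrow>\<^sub>M count_space UNIV"
proof -
  let ?f = "\<lambda>sel h k. if sel = Some k then s k - threshold_level net
     else min (top_level net) (s k + quantize net (harvested net sel h k))"
  have "(\<lambda>h. ?f sel h k) \<in> slot_law net \<rightarrow>\<^sub>M count_space UNIV" for sel k
  proof (cases "sel = Some k")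
    case False
    note [measurable] = measurable_harvested[OF False]
    have "(\<lambda>h. quantize net (harvested net sel h k)) \<in> slot_law net \<rightarrow>\<^sub>M count_space UNIV"
      by measurable
    then show ?thesis using False by simp
  qed simp
  then have "Measurable.pred (slot_law net) (\<lambda>h. \<forall>k. ?f sel h k = s' k)" for sel s'
    by measurable
  then have "Measurable.pred (slot_law net) (\<lambda>h. ?f sel h = s')" for sel s'
    by (simp only: fun_eq_iff)
  then have "?f sel \<in> slot_law net \<rightarrow>\<^sub>M count_space UNIV" for sel
    by (subst measurable_count_space_eq2_countable) (auto simp: pred_def vimage_def Int_def conj_commute)
  then have "(\<lambda>h. ?f (selected net s h) h) \<in> slot_law net \<rightarrow>\<^sub>M count_space UNIV"
    by (rule measurable_compose_countable) measurable
  then show ?thesis by (simp add: next_state_def[abs_def])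
qed

text \<open>\<open>S\<^sub>i\<close> is selected whenever the channel from \<open>S\<^sub>i\<close> to the destination exceeds 1 in modulus
  and all others stay below 1.\<close>

lemma selection_prob_pos:
  assumes i: "i \<in> eligible net s"
  shows "selection_prob net s i > 0"
proof -
  interpret prob_space "slot_law net" by (rule prob_space_slot_law)
  \<comment> \<open>Real and imaginary parts lie in \<open>(1, 2)\<close> for the channel
    \<open>SD i\<close> and in \<open>(-1/2, 1/2)\<close> for all others, whose squared moduli are
    thus at most \<open>1/4 + 1/4\<close>.\<close>
  define a :: "('nb, 'k) link \<Rightarrow> real" where "a c = (if c = SD i then 1 else - 1/2)" for c
  define b :: "('nb, 'k) link \<Rightarrow> real" where "b c = (if c = SD i then 2 else 1/2)" for c
  define R where "R = (\<Pi>\<^sub>E c\<in>channels. {z. Re z \<in> {a c<..<b c} \<and> Im z \<in> {a c<..<b c}})"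
  have "selected net s h = Some i" if h: "h \<in> R" for h
  proof -
    have hc: "Re (h c) \<in> {a c<..<b c}" "Im (h c) \<in> {a c<..<b c}" if "c \<in> channels" for c
      using PiE_mem[OF h[unfolded R_def] that] by blast+
    have big: "1 < (cmod (h (SD i)))\<^sup>2"
    proof -
      have "1 < (Re (h (SD i)))\<^sup>2" using hc[of "SD i"] by (simp add: a_def one_less_power)
      then show ?thesis
        unfolding cmod_power2 by (rule less_le_trans) simp
    qed
    have small: "(cmod (h (SD k)))\<^sup>2 < 1" if "k \<noteq> i" for k
    proof -
      have "\<bar>Re (h (SD k))\<bar> \<le> 1/2" "\<bar>Im (h (SD k))\<bar> \<le> 1/2"
        using hc[of "SD k"] that by (auto simp: a_def b_def)
      then have "(Re (h (SD k)))\<^sup>2 \<le> (1/2)\<^sup>2" "(Im (h (SD k)))\<^sup>2 \<le> (1/2)\<^sup>2"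
        by (auto simp only: abs_le_square_iff[symmetric] abs_divide abs_one abs_numeral)
      moreover have "(1/2)\<^sup>2 = (1/4 :: real)" by (simp add: power2_eq_square)
      ultimately show ?thesis unfolding cmod_power2 by linarith
    qed
    have "(cmod (h (SD k)))\<^sup>2 < (cmod (h (SD i)))\<^sup>2" if "k \<noteq> i" for k
      using small[OF that] big by linarith
    \<comment> \<open>The maximizer is unique, so the choice in \<open>arg_max\<close> is
      determined.\<close>
    then have "is_arg_max (\<lambda>k. (cmod (h (SD k)))\<^sup>2) (\<lambda>k. k \<in> eligible net s) k \<longleftrightarrow> k = i" for k
      using i unfolding is_arg_max_def by (cases "k = i") (auto dest: less_asym)
    then show ?thesis
      using i by (auto simp: selected_def arg_max_def)
  qed
  moreover have pos: "emeasure (slot_law net) R > 0"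
    unfolding R_def by (rule emeasure_slot_law_rectangle) (simp add: a_def b_def)
  \<comment> \<open>\<open>emeasure\<close> is 0 outside the sigma-algebra, so positive measure
    already implies measurability.\<close>
  moreover have "R \<in> events"
    using pos emeasure_notin_sets[of R "slot_law net"] by fastforce
  ultimately have "R \<subseteq> {h \<in> space (slot_law net). selected net s h = Some i}"
    using sets.sets_into_space by blast
  then have "emeasure (slot_law net) R \<le> emeasure (slot_law net) {h \<in> space (slot_law net). selected net s h = Some i}"
    by (rule emeasure_mono) measurable
  with pos have "emeasure (slot_law net) {h \<in> space (slot_law net). selected net s h = Some i} > 0"
    by (rule less_le_trans)
  then show ?thesis
    by (simp add: selection_prob_def emeasure_eq_measure)
qed

end


subsection \<open>The chain of energy states\<close>

lemma next_state_in_states: "s \<in> states net \<Longrightarrow> next_state net s h \<in> states net"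
  by (auto simp: next_state_def states_def intro: le_trans[OF diff_le_self])

lemma tx_prob_eq_0: "s \<notin> tx_states net \<Longrightarrow> s \<in> states net \<Longrightarrow> tx_prob net s i = 0"
  by (simp add: tx_states_def tx_prob_def selection_prob_def selected_def)

locale energy_chain =
  fixes net :: "('nb::finite, 'k::finite) network"
    and \<sigma> :: "'n::finite \<Rightarrow> 'k state" and A :: "real ^ 'n ^ 'n"
  assumes net: "valid_network net"
    and \<sigma>: "bij_betw \<sigma> UNIV (states net)"
    and A_def: "A = transition_matrix net \<sigma>"
    and A_stochastic: "row_stochastic A"
    and A_irreducible: "irreducible_matrix A"
begin

lemma sum_states: "(\<Sum>s\<in>states net. g s) = (\<Sum>n\<in>UNIV. g (\<sigma> n))"
  using sum.reindex_bij_betw[OF \<sigma>, of g] by simp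

lemma \<sigma>_in_states: "\<sigma> n \<in> states net"
  using \<sigma> by (auto simp: bij_betw_def)

lemma finite_states: "finite (states net)"
  using bij_betw_finite[OF \<sigma>] by simp

lemma is_stationary_iff:
  "is_stationary net \<nu> \<longleftrightarrow> set_pmf \<nu> \<subseteq> states net \<and>
     transpose A *v (\<chi> n. pmf \<nu> (\<sigma> n)) = (\<chi> n. pmf \<nu> (\<sigma> n))"
proof -
  have "states net = range \<sigma>" using \<sigma> by (auto simp: bij_betw_def)
  then have all: "(\<forall>s'\<in>states net. P s') \<longleftrightarrow> (\<forall>n. P (\<sigma> n))" for P by auto
  show ?thesis
    unfolding is_stationary_def all sum_states vec_eq_iff stationary_component
    by (intro conj_cong refl all_cong1, subst eq_commute[of "pmf \<nu> (\<sigma> n)" for n])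
       (simp add: A_def transition_matrix_def)
qed

lemma sum_stationary:
  assumes "set_pmf \<nu> \<subseteq> states net"
  shows "(\<Sum>n\<in>UNIV. (\<chi> n. pmf \<nu> (\<sigma> n)) $ n) = 1"
  using sum_pmf_eq_1[OF finite_states assms] by (simp add: sum_states)

abbreviation system :: "real ^ 'n ^ 'n" where
  "system \<equiv> transpose A - mat 1 + (\<chi> p q. 1)"

abbreviation solution :: "real ^ 'n" where
  "solution \<equiv> matrix_inv system *v (\<chi> p. 1)"

text \<open>The normalization is automatic for a probability law on the states, so stationarity is
  equivalent to the linear system.\<close>

lemma is_stationary_iff_solution:
  "is_stationary net \<nu> \<longleftrightarrow> set_pmf \<nu> \<subseteq> states net \<and> (\<chi> n. pmf \<nu> (\<sigma> n)) = solution"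
  using is_stationary_iff[of \<nu>] sum_stationary[of \<nu>]
    stationary_system_iff[OF A_stochastic A_irreducible refl refl, of "\<chi> n. pmf \<nu> (\<sigma> n)"]
    stationary_system_solution[OF A_stochastic A_irreducible refl refl, of "\<chi> n. pmf \<nu> (\<sigma> n)"]
  by blast

lemma solution:
  "transpose A *v solution = solution" "(\<Sum>n\<in>UNIV. solution $ n) = 1" "solution $ n > 0"
proof -
  show 1: "transpose A *v solution = solution" and 2: "(\<Sum>n\<in>UNIV. solution $ n) = 1"
    using stationary_system_iff[OF A_stochastic A_irreducible refl refl, of solution]
      stationary_system_solution[OF A_stochastic A_irreducible refl refl, of solution]
    by blast+
  show "solution $ n > 0"
    by (rule stationary_solution_pos[OF A_stochastic A_irreducible 1 2])
qed

lemma ex1_stationary: "\<exists>!\<nu>. is_stationary net \<nu>"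
proof (rule ex_ex1I)
  \<comment> \<open>Existence: \<open>solution\<close> is positive with sum 1, hence a probability
    law on the indices, which \<open>\<sigma>\<close> transports to the states. For uniqueness, the
    linear system fixes the values on \<open>states net\<close>, and all others are 0.\<close>
  define \<mu> where "\<mu> = embed_pmf (\<lambda>n. solution $ n)"
  have "(\<integral>\<^sup>+n. ennreal (solution $ n) \<partial>count_space UNIV) = 1"
    using solution(2) solution(3)[THEN less_imp_le]
    by (simp add: nn_integral_count_space_finite)
  then have pmf_\<mu>: "pmf \<mu> n = solution $ n" for n
    unfolding \<mu>_def using solution(3)[THEN less_imp_le] by (intro pmf_embed_pmf)
  have "inj \<sigma>" using \<sigma> by (simp add: bij_betw_def)
  then have "is_stationary net (map_pmf \<sigma> \<mu>)"
    unfolding is_stationary_iff_solution vec_eq_iff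
    by (auto simp: pmf_map_inj' pmf_\<mu> \<sigma>_in_states)
  then show "\<exists>\<nu>. is_stationary net \<nu>" ..
next
  fix \<nu> \<nu>' assume *: "is_stationary net \<nu>" "is_stationary net \<nu>'"
  show "\<nu> = \<nu>'"
  proof (rule pmf_eqI)
    fix s
    show "pmf \<nu> s = pmf \<nu>' s"
    proof (cases "s \<in> states net")
      case True
      then obtain n where "s = \<sigma> n" using \<sigma> by (auto simp: bij_betw_def)
      moreover have "(\<chi> n. pmf \<nu> (\<sigma> n)) = (\<chi> n. pmf \<nu>' (\<sigma> n))"
        using * by (simp only: is_stationary_iff_solution)
      ultimately show ?thesis by (simp add: vec_eq_iff)
    next
      case False
      then have "s \<notin> set_pmf \<nu>" "s \<notin> set_pmf \<nu>'"
        using * by (auto simp: is_stationary_def)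
      then show ?thesis by (simp add: set_pmf_iff)
    qed
  qed
qed

lemma stationary_law: "is_stationary net (stationary_law net)"
  unfolding stationary_law_def by (rule theI'[OF ex1_stationary])

lemma set_stationary_law: "set_pmf (stationary_law net) \<subseteq> states net"
  using stationary_law by (simp add: is_stationary_def)

lemma stationary_vector_eq: "stationary_vector net \<sigma> = solution"
  using stationary_law by (simp add: is_stationary_iff_solution stationary_vector_def)

section \<open>Average transmission probability\<close>

lemma avg_tx_prob_sum:
  "avg_tx_prob net i = (\<Sum>s\<in>states net. pmf (stationary_law net) s * tx_prob net s i)"
  unfolding avg_tx_prob_def
  by (subst integral_measure_pmf_real[OF finite_states])
     (use set_stationary_law in \<open>auto simp: mult.commute\<close>)

lemma avg_tx_prob_eq:
  "avg_tx_prob net i = (\<Sum>n\<in>UNIV. stationary_vector net \<sigma> $ n * tx_prob net (\<sigma> n) i)"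
  by (simp add: avg_tx_prob_sum sum_states stationary_vector_def)

lemma avg_tx_prob_eq_tx_states:
  "avg_tx_prob net i =
     (\<Sum>n | \<sigma> n \<in> tx_states net. stationary_vector net \<sigma> $ n * tx_prob net (\<sigma> n) i)"
  unfolding avg_tx_prob_eq
  by (rule sum.mono_neutral_right) (auto simp: tx_prob_eq_0 \<sigma>_in_states)

lemma ex_tx_prob_pos: "\<exists>n. tx_prob net (\<sigma> n) i > 0"
proof -
  \<comment> \<open>The witness is the state with full storages, where every source reaches both
    \<open>threshold_level\<close> and \<open>tx_level\<close>.\<close>
  have "(\<lambda>_. top_level net) \<in> states net" by (simp add: states_def)
  then obtain n where n: "\<sigma> n = (\<lambda>_. top_level net)"
    using \<sigma> by (metis bij_betw_def imageE)
  have "threshold_level net \<le> top_level net" "tx_level net \<le> top_level net"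
    using net by (auto simp: valid_network_def)
  then have "tx_prob net (\<sigma> n) i > 0"
    using selection_prob_pos[OF net, of i "\<sigma> n"] by (simp add: tx_prob_def n eligible_def)
  then show ?thesis ..
qed

lemma tx_prob_nonneg: "tx_prob net s i \<ge> 0"
  by (simp add: tx_prob_def selection_prob_def)

lemma avg_tx_prob_pos: "avg_tx_prob net i > 0"
proof -
  obtain n where "tx_prob net (\<sigma> n) i > 0" using ex_tx_prob_pos ..
  then show ?thesis
    unfolding avg_tx_prob_eq stationary_vector_eq
    by (intro sum_pos2[of _ n]) (auto intro!: mult_nonneg_nonneg mult_pos_pos
        simp: tx_prob_nonneg solution(3) less_imp_le)
qed

section \<open>Average transmission delay\<close>

abbreviation tx :: "'k \<Rightarrow> 'k state \<Rightarrow> (('nb, 'k) link \<Rightarrow> complex) \<Rightarrow> bool" where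
  "tx i s h \<equiv> selected net s h = Some i \<and> s i \<ge> tx_level net"

lemma random_dynamics: "random_dynamics (slot_law net) (next_state net) (tx i) (states net)"
proof -
  interpret prob_space "slot_law net" by (rule prob_space_slot_law[OF net])
  show ?thesis
  proof
    show "next_state net s \<in> slot_law net \<rightarrow>\<^sub>M count_space UNIV" for s
      by (rule measurable_next_state[OF net])
    note [measurable] = measurable_selected[OF net]
    show "Measurable.pred (slot_law net) (tx i s)" for s
      by measurable
  qed (auto simp: finite_states next_state_in_states)
qed

lemma prob_tx: "\<P>(h in slot_law net. tx i s h) = tx_prob net s i"
  by (auto simp: tx_prob_def selection_prob_def not_less)

text \<open>\<open>B\<close> is the chain killed at a transmission of source \<open>i\<close>, and
  \<open>v n\<close> holds its survival probabilities. Some state has positive transmission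
  probability, so its row of \<open>B\<close> is deficient and the survival probabilities
  decay.\<close>

lemma prob_quiet_tendsto_0:
  assumes "s \<in> states net"
  shows "(\<lambda>n. \<P>(h in Pi\<^sub>M UNIV (\<lambda>_. slot_law net).
      random_dynamics.quiet (next_state net) (tx i) n s h)) \<longlonglongrightarrow> 0"
proof -
  interpret D: random_dynamics "slot_law net" "next_state net" "tx i" "states net"
    by (rule random_dynamics)
  define B :: "real ^ 'n ^ 'n" where
    "B = (\<chi> p q. \<P>(h in slot_law net. \<not> tx i (\<sigma> p) h \<and> next_state net (\<sigma> p) h = \<sigma> q))"
  define v :: "nat \<Rightarrow> real ^ 'n" where
    "v n = (\<chi> p. \<P>(h in D.Seq.S. D.quiet n (\<sigma> p) h))" for n
  obtain p0 where p0: "tx_prob net (\<sigma> p0) i > 0" using ex_tx_prob_pos ..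
  have v_Suc: "v (Suc n) = B *v v n" for n
    by (simp only: vec_eq_iff v_def B_def matrix_vector_mult_def vec_lambda_beta
        D.prob_quiet_Suc[OF \<sigma>_in_states] sum_states) simp
  note [measurable] = measurable_selected[OF net]
  have "(\<Sum>q\<in>UNIV. B $ p0 $ q) =
      (\<Sum>s'\<in>states net. \<P>(h in slot_law net. \<not> tx i (\<sigma> p0) h \<and> next_state net (\<sigma> p0) h = s'))"
    by (simp only: sum_states B_def vec_lambda_beta)
  also have "\<dots> = \<P>(h in slot_law net. \<not> tx i (\<sigma> p0) h)"
    by (rule D.sum_prob_step[OF _ \<sigma>_in_states]) measurable
  also have "\<dots> = 1 - \<P>(h in slot_law net. tx i (\<sigma> p0) h)"
    by (rule D.prob_neg) (rule predE[OF D.T_measurable])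
  also have "\<dots> = 1 - tx_prob net (\<sigma> p0) i"
    by (simp only: prob_tx)
  finally have row: "(\<Sum>q\<in>UNIV. B $ p0 $ q) < 1" using p0 by simp
  have B_le: "B $ p $ q \<le> A $ p $ q" for p q
    using D.prob_split_T[of "\<sigma> p" "\<sigma> q"]
    by (simp add: A_def B_def transition_matrix_def step_prob_def)
  obtain p where "s = \<sigma> p" using assms \<sigma> by (auto simp: bij_betw_def)
  moreover have "(\<lambda>n. v n $ p) \<longlonglongrightarrow> 0"
  proof (rule substochastic_power_tendsto_0[OF A_stochastic A_irreducible])
    show "0 \<le> B $ p $ q" for p q by (simp add: B_def)
    show "v 0 = (\<chi> p. 1)" unfolding v_def D.prob_quiet_0 ..
  qed (fact B_le row v_Suc)+
  ultimately show ?thesis by (simp add: v_def)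
qed

text \<open>Kac's formula for the event \<open>tx i\<close>, once energy states and waiting slots
  are identified with \<open>path\<close> and \<open>waiting\<close>. Positivity of
  \<open>slot_length\<close> and \<open>avg_tx_prob\<close> turns the extended quotient into a real
  one.\<close>

lemma avg_tx_delay_eq: "avg_tx_delay net i = ennreal (slot_length net / avg_tx_prob net i)"
proof -
  interpret D: random_dynamics "slot_law net" "next_state net" "tx i" "states net"
    by (rule random_dynamics)
  let ?\<nu> = "stationary_law net"
  have path: "energy_state net \<omega> t = D.path (fst \<omega>) (snd \<omega>) t" for \<omega> t
    by (induction t) simp_all
  have "pmf ?\<nu> s' = (\<Sum>s\<in>states net. \<P>(h in slot_law net. next_state net s h = s') * pmf ?\<nu> s)"
    if "s' \<in> states net" for s'
    using stationary_law that by (simp add: is_stationary_def step_prob_def)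
  note cond = D.conditional_expected_waiting[OF set_stationary_law this prob_quiet_tendsto_0]
  have "slot_length net > 0" using net by (simp add: valid_network_def)
  moreover have "avg_tx_delay net i = ennreal (slot_length net) * (1 / ennreal (avg_tx_prob net i))"
    unfolding avg_tx_delay_def Let_def operation_law_def avg_tx_prob_sum
    using cond
    by (simp add: waiting_slots_def[abs_def] D.waiting_def[abs_def] transmits_def path prob_tx)
  ultimately show ?thesis
    using avg_tx_prob_pos[of i]
    by (simp add: divide_ennreal flip: ennreal_1 ennreal_mult')
qed

end

text \<open>Besides the formulas, three facts give the notation its meaning: uniqueness for the
  definite description in \<open>stationary_law\<close>, invertibility for
  \<open>matrix_inv\<close>, and positivity of \<open>avg_tx_prob\<close> for the division.\<close>

theorem theorem3:
  fixes net :: "('nb::finite, 'k::finite) network"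
    and \<sigma> :: "'n::finite \<Rightarrow> 'k state"
    and A Q :: "real ^ 'n ^ 'n" and b \<pi> :: "real ^ 'n"
    and i :: 'k
  assumes "valid_network net"
    and "bij_betw \<sigma> UNIV (states net)"
    and "A = transition_matrix net \<sigma>"
    and "row_stochastic A"
    and "irreducible_matrix A"
    and "Q = (\<chi> p q. 1)"
    and "b = (\<chi> p. 1)"
    and "\<pi> = stationary_vector net \<sigma>"
  shows "(\<exists>!\<nu>. is_stationary net \<nu>)
    \<and> invertible (transpose A - mat 1 + Q)
    \<and> \<pi> = matrix_inv (transpose A - mat 1 + Q) *v b
    \<and> avg_tx_prob net i = (\<Sum>n\<in>UNIV. \<pi> $ n * tx_prob net (\<sigma> n) i)
    \<and> avg_tx_prob net i = (\<Sum>n | \<sigma> n \<in> tx_states net. \<pi> $ n * tx_prob net (\<sigma> n) i)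
    \<and> avg_tx_prob net i > 0
    \<and> avg_tx_delay net i = ennreal (slot_length net / avg_tx_prob net i)
    \<and> avg_tx_delay net i =
        ennreal (slot_length net / (\<Sum>n | \<sigma> n \<in> tx_states net. \<pi> $ n * tx_prob net (\<sigma> n) i))"
proof -
  interpret energy_chain net \<sigma> A
    using assms(1-5) by unfold_locales
  show ?thesis
    unfolding assms(6-8)
    using ex1_stationary stationary_system_invertible[OF A_stochastic A_irreducible refl refl]
      stationary_vector_eq avg_tx_prob_eq avg_tx_prob_eq_tx_states avg_tx_prob_pos avg_tx_delay_eq
    by (metis (no_types, lifting))
qed

end
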